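(* Let $d$ be a natural number that is not a perfect square. Put $x:=\lfloor\sqrt d\rfloor+\sqrt d$, let $(x_n)_{n\ge0}$ be the sequence of complete quotients of $x$, let $\sqrt d=[a_0,a_1,a_2,\dots]$ be the continued fraction expansion of $\sqrt d$ and, for every $n$, let $\frac{p_n}{q_n}$ be the convergent of index $n$ of this expansion. 1. The continued fraction expansion of $\sqrt d$ is periodic from rank $1$. More precisely, with $T$ its smallest period, it has the form $\sqrt d=[a_0,\overline{a_1,a_2,\dots,a_{T-1},2a_0}]$. Moreover, for every $k\in\{1,\dots,T-1\}$, $a_k=a_{T-k}$ (that is, the list $(a_1,\dots,a_{T-1})$ is a palindrome). 2. There exist two $T$-periodic sequences of positive integers $(u_n)_{n\ge0}$ and $(v_n)_{n\ge0}$ such that, for every $n\in\mathbb N$, $x_n=\dfrac{u_n+\sqrt d}{v_n}$, $u_n\le a_0$, and $v_n$ divides $d-u_n^2$. 3. For every $n\ge 0$, $p_{n-1}^2-dq_{n-1}^2=(-1)^n v_n$. 4. The smallest period $T$ of the expansion of $\sqrt d$ is the first index $k$ such that $a_k=2a_0$. 5. If there exists an integer $N\in\{1,\dots,T-1\}$ such that $v_N$ divides $u_N$, then $T=2N$ and, in particular, $T$ is even.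
   Context: $\mathbb N=\{0,1,2,\dots\}$. Continued fractions: for an irrational $z$, put $z_0:=z$, $c_n:=\lfloor z_n\rfloor$ and $z_{n+1}:=1/(z_n-c_n)$ for $n\ge0$; the $z_n$ are the complete quotients of $z$, the $c_n$ are its partial quotients, and the continued fraction expansion of $z$ is $z=[c_0,c_1,c_2,\dots]$. The convergent of index $n$ is $[c_0,\dots,c_n]=\frac{p_n}{q_n}$ (in lowest terms), where $p_{-2}=0$, $p_{-1}=1$, $q_{-2}=1$, $q_{-1}=0$ and $p_n=c_np_{n-1}+p_{n-2}$, $q_n=c_nq_{n-1}+q_{n-2}$ for $n\ge 0$. The notation $[c_0,\dots,c_{N-1},\overline{c_N,\dots,c_{N+T-1}}]$ means that the sequence $(c_n)$ is periodic of period $T$ from rank $N$ on. The sequences $(u_n),(v_n)$ in items 3 and 5 are those of item 2 (they are uniquely determined by the relation $x_n=\frac{u_n+\sqrt d}{v_n}$, since $\sqrt d$ is irrational). *)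

theory Defs
  imports Complex_Main "HOL-Computational_Algebra.Nth_Powers"
begin

primrec complete_quotient :: "real \<Rightarrow> nat \<Rightarrow> real" where
  "complete_quotient z 0 = z"
| "complete_quotient z (Suc n) =
     1 / (complete_quotient z n - of_int \<lfloor>complete_quotient z n\<rfloor>)"

definition partial_quotient :: "real \<Rightarrow> nat \<Rightarrow> int" where
  "partial_quotient z n = \<lfloor>complete_quotient z n\<rfloor>"

(* The convergents are indexed by integers because the recursion starts at index -2;
   indices below -2 are never used and receive the value at -2. *)
function conv_num :: "(nat \<Rightarrow> int) \<Rightarrow> int \<Rightarrow> int" where
  "conv_num c i =
     (if i \<le> -2 then 0 else if i = -1 then 1
      else c (nat i) * conv_num c (i - 1) + conv_num c (i - 2))"
  by pat_completeness auto
termination by (relation "measure (\<lambda>(c, i). nat (i + 2))") auto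

function conv_denom :: "(nat \<Rightarrow> int) \<Rightarrow> int \<Rightarrow> int" where
  "conv_denom c i =
     (if i \<le> -2 then 1 else if i = -1 then 0
      else c (nat i) * conv_denom c (i - 1) + conv_denom c (i - 2))"
  by pat_completeness auto
termination by (relation "measure (\<lambda>(c, i). nat (i + 2))") auto

declare conv_num.simps [simp del] conv_denom.simps [simp del]

lemma conv_num_rec:
  "conv_num c (-2) = 0"
  "conv_num c (-1) = 1"
  "conv_num c (int n) = c n * conv_num c (int n - 1) + conv_num c (int n - 2)"
  by (simp_all add: conv_num.simps [of c "-2"] conv_num.simps [of c "-1"]
      conv_num.simps [of c "int n"])

lemma conv_denom_rec:
  "conv_denom c (-2) = 1"
  "conv_denom c (-1) = 0"
  "conv_denom c (int n) = c n * conv_denom c (int n - 1) + conv_denom c (int n - 2)"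
  by (simp_all add: conv_denom.simps [of c "-2"] conv_denom.simps [of c "-1"]
      conv_denom.simps [of c "int n"])

definition periodic_from :: "nat \<Rightarrow> nat \<Rightarrow> (nat \<Rightarrow> 'a) \<Rightarrow> bool" where
  "periodic_from N T c \<longleftrightarrow> T > 0 \<and> (\<forall>n\<ge>N. c (n + T) = c n)"

(* Only meaningful together with the existence of some T with periodic_from N T c. *)
definition smallest_period :: "nat \<Rightarrow> (nat \<Rightarrow> 'a) \<Rightarrow> nat" where
  "smallest_period N c = (LEAST T. periodic_from N T c)"

end

theory Submission
  imports Defs
begin

text \<open>
  Write \<open>s\<close> for the square root of \<open>d\<close>.  Every complete quotient of \<open>\<lfloor>s\<rfloor> + s\<close> is a surd
  \<open>(u + s) / v\<close> with integers \<open>u\<close>, \<open>v\<close> such that \<open>v\<close> divides \<open>d - u\<^sup>2\<close>, and it is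
  reduced in Galois' sense: it exceeds \<open>1\<close> and its conjugate lies strictly between \<open>-1\<close> and
  \<open>0\<close>.  The expansion is therefore an iteration on a bounded set of integer pairs, the states
  (\<open>reduced_step\<close>, \<open>complete_quotient_eq\<close>).

  Two consecutive states \<open>(u, v)\<close>, \<open>(u', v')\<close> with partial quotient \<open>c\<close> satisfy
  \<open>u + u' = c v\<close>, \<open>d - u'\<^sup>2 = v v'\<close> and \<open>c = \<lfloor>(u' + s) / v\<rfloor>\<close>.  The last equation
  (\<open>digit_backward\<close>) makes the iteration reversible by the same rule read backwards, and this
  has two consequences.  The iteration is injective, so by finiteness it returns to its
  initial state: the sequence of states is purely periodic.  And since the step starting
  at the initial state is its own mirror image, the whole cycle is: \<open>reflection\<close> says that
  \<open>(u (k + 1), v k)\<close> is the state at \<open>T - k\<close>, which makes the partial quotients a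
  palindrome.  If \<open>v N\<close> divides \<open>u N\<close>, then reducedness forces \<open>u (N + 1) = u N\<close>, so
  the states at \<open>N\<close> and \<open>T - N\<close> coincide and \<open>T = 2 N\<close> (\<open>period_symmetric_state\<close>).

  The partial quotient \<open>2 \<lfloor>s\<rfloor>\<close> occurs exactly at returns to the initial state
  (\<open>digit_max_iff\<close>).  A period of the partial quotients must carry one such occurrence to
  another, so it is a period of the states as well; this identifies the smallest period \<open>T\<close>
  with the first return.

  Finally, \<open>s\<close> is the image of a complete quotient under the Moebius map given by two
  consecutive convergents.  Comparing rational and irrational parts gives two integer
  identities (\<open>convergent_surd\<close>), from which the norm of a convergent follows by the
  determinant formula.
\<close>

section \<open>Complete quotients and convergents\<close>

lemma complete_quotient_add_int:
  "complete_quotient (of_int m + z) (Suc n) = complete_quotient z (Suc n)"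
  by (induction n) auto

lemma conv_num_Suc:
  "conv_num c (int (Suc n)) = c (Suc n) * conv_num c (int n) + conv_num c (int n - 1)"
  using conv_num_rec(3)[of c "Suc n"] by (simp add: algebra_simps)

lemma conv_denom_Suc:
  "conv_denom c (int (Suc n)) = c (Suc n) * conv_denom c (int n) + conv_denom c (int n - 1)"
  using conv_denom_rec(3)[of c "Suc n"] by (simp add: algebra_simps)

lemma conv_determinant:
  "conv_num c (int n) * conv_denom c (int n - 1) - conv_num c (int n - 1) * conv_denom c (int n)
     = (-1) ^ Suc n"
proof (induction n)
  case 0
  show ?case using conv_num_rec(3)[of c 0] conv_denom_rec(3)[of c 0]
    by (simp add: conv_num_rec(1,2) conv_denom_rec(1,2))
next
  case (Suc n)
  have "int (Suc n) - 1 = int n" by simp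
  then show ?case using Suc by (simp only: conv_num_Suc conv_denom_Suc) (simp add: algebra_simps)
qed

section \<open>Reduced quadratic surds\<close>

locale nonsquare_root =
  fixes d :: nat
  assumes nonsquare: "\<not> is_square d"
begin

abbreviation s :: real where "s \<equiv> sqrt (real d)"

text \<open>
  The bounds say that \<open>(u + s) / v > 1\<close> and that the conjugate \<open>(u - s) / v\<close> lies strictly
  between \<open>-1\<close> and \<open>0\<close>, multiplied out by \<open>v > 0\<close> (positivity follows from the first two).
\<close>
definition reduced :: "int \<Rightarrow> int \<Rightarrow> bool" where
  "reduced u v \<longleftrightarrow> of_int u < s \<and> s - of_int u < of_int v \<and> of_int v < s + of_int u
     \<and> v dvd int d - u\<^sup>2"

definition digit :: "int \<Rightarrow> int \<Rightarrow> int" where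
  "digit u v = \<lfloor>(of_int u + s) / of_int v\<rfloor>"

definition step :: "int \<times> int \<Rightarrow> int \<times> int" where
  "step = (\<lambda>(u, v). let w = digit u v * v - u in (w, (int d - w\<^sup>2) div v))"

definition state :: "nat \<Rightarrow> int \<times> int" where
  "state n = (step ^^ n) (\<lfloor>s\<rfloor>, 1)"

definition u :: "nat \<Rightarrow> int" where "u n = fst (state n)"
definition v :: "nat \<Rightarrow> int" where "v n = snd (state n)"
definition c :: "nat \<Rightarrow> int" where "c n = digit (u n) (v n)"

lemma root_not_int: "real_of_int w \<noteq> s"
proof
  assume "real_of_int w = s"
  then have "(real_of_int w)\<^sup>2 = real d" by simp
  then have "w\<^sup>2 = int d" by (metis of_int_of_nat_eq of_int_eq_iff of_int_power)
  then have "(nat \<bar>w\<bar>)\<^sup>2 = d" by (simp add: flip: nat_power_eq)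
  then show False using nonsquare by (metis is_nth_powerI)
qed

lemma floor_root_pos: "\<lfloor>s\<rfloor> \<ge> 1"
proof -
  have "d \<noteq> 0" using root_not_int[of 0] by auto
  then have "s \<ge> 1" by simp
  then show ?thesis by simp
qed

lemma floor_root_less: "of_int \<lfloor>s\<rfloor> < s"
  using root_not_int[of "\<lfloor>s\<rfloor>"] by (simp add: order_less_le)

lemma reduced_pos:
  assumes "reduced m k"
  shows "m > 0" "k > 0"
proof -
  have "0 < real_of_int m" "0 < real_of_int k" using assms unfolding reduced_def by linarith+
  then show "m > 0" "k > 0" by simp_all
qed

lemma reduced_start: "reduced \<lfloor>s\<rfloor> 1"
proof -
  have "real_of_int \<lfloor>s\<rfloor> \<ge> 1" using floor_root_pos by simp
  then show ?thesis using floor_root_less unfolding reduced_def by (simp, linarith)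
qed

text \<open>
  All the bounds come from \<open>k k' = (s - w) (s + w)\<close>: the floor and the irrationality of \<open>s\<close> give
  \<open>0 < s - w < k < s + w\<close>, where the last inequality uses that the partial quotient is at least \<open>1\<close>, and dividing the
  product by \<open>k\<close> exchanges these bounds into those for \<open>k'\<close>.
\<close>
lemma reduced_step:
  assumes red: "reduced m k" and w: "w = digit m k * k - m"
  obtains k' where "int d - w\<^sup>2 = k * k'" "(int d - w\<^sup>2) div k = k'" "reduced w k'"
    and "s - of_int w < of_int k" "of_int w < s" "of_int k < s + of_int w"
proof -
  have k: "k > 0" using reduced_pos[OF red] by simp
  then have kr: "real_of_int k > 0" by simp
  have lo: "real_of_int (digit m k) * k \<le> of_int m + s"
    unfolding digit_def by (rule iffD1[OF pos_le_divide_eq[OF kr] of_int_floor_le])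
  have hi: "of_int m + s < (real_of_int (digit m k) + 1) * k"
    unfolding digit_def
    by (rule iffD1[OF pos_divide_less_eq[OF kr]]) (rule floor_correct[THEN conjunct2, unfolded of_int_add of_int_1])
  have d1: "digit m k \<ge> 1"
    unfolding digit_def using red kr by (simp add: reduced_def field_simps)
  have wr: "real_of_int w = real_of_int (digit m k) * k - m" by (simp add: w)
  have w1: "of_int w < s" using lo wr root_not_int[of w] by linarith
  have w2: "s - of_int w < of_int k" using hi wr by (simp add: algebra_simps)
  have "real_of_int (digit m k) * k \<ge> k" using d1 kr by simp
  then have w3: "of_int k < s + of_int w" using wr red unfolding reduced_def by linarith
  have "int d - w\<^sup>2 = (int d - m\<^sup>2) + k * (2 * digit m k * m - (digit m k)\<^sup>2 * k)"
    by (simp add: w power2_eq_square algebra_simps)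
  moreover have "k dvd int d - m\<^sup>2" using red unfolding reduced_def by simp
  ultimately have "k dvd int d - w\<^sup>2" by (metis dvd_add dvd_triv_left)
  then obtain k' where k': "int d - w\<^sup>2 = k * k'" by (elim dvdE)
  have prod: "real_of_int k * of_int k' = (s - of_int w) * (s + of_int w)"
  proof -
    have "real_of_int k * of_int k' = real_of_int (int d - w\<^sup>2)" by (simp add: k')
    also have "\<dots> = s\<^sup>2 - (of_int w)\<^sup>2" by simp
    finally show ?thesis by (simp add: power2_eq_square algebra_simps)
  qed
  have pos: "s - of_int w > 0" "s + of_int w > 0" using w1 w3 kr by linarith+
  have "of_int k * (s - of_int w) < of_int k * of_int k'"
    unfolding prod using w3 pos by (simp add: mult.commute)
  then have r1: "s - of_int w < of_int k'" using kr by simp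
  have "of_int k * of_int k' < of_int k * (s + of_int w)"
    unfolding prod using w2 pos by (intro mult_strict_right_mono)
  then have r2: "of_int k' < s + of_int w" using kr by simp
  have "reduced w k'" unfolding reduced_def using w1 r1 r2 k' by simp
  moreover have "(int d - w\<^sup>2) div k = k'" using k k' by simp
  ultimately show ?thesis using that k' w1 w2 w3 by blast
qed

lemma state_Suc: "state (Suc n) = step (state n)"
  by (simp add: state_def)

lemma u_Suc: "u (Suc n) = c n * v n - u n"
  by (simp add: u_def v_def c_def state_Suc step_def case_prod_beta Let_def)

lemma v_Suc: "v (Suc n) = (int d - (u (Suc n))\<^sup>2) div v n"
  by (simp add: u_def v_def c_def state_Suc step_def case_prod_beta Let_def)

lemma start: "u 0 = \<lfloor>s\<rfloor>" "v 0 = 1"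
  by (simp_all add: u_def v_def state_def)

lemma reduced_seq: "reduced (u n) (v n)"
proof (induction n)
  case 0
  show ?case using reduced_start by (simp add: start)
next
  case (Suc n)
  from reduced_step[OF Suc u_Suc[unfolded c_def]] show ?case by (metis v_Suc)
qed

lemmas u_pos = reduced_pos(1)[OF reduced_seq]
lemmas v_pos = reduced_pos(2)[OF reduced_seq]

lemma norm_eq: "int d - (u (Suc n))\<^sup>2 = v n * v (Suc n)"
  by (rule reduced_step[OF reduced_seq[of n] u_Suc[of n, unfolded c_def]]) (metis v_Suc)

lemma u_le: "u n \<le> \<lfloor>s\<rfloor>"
  using reduced_seq[of n] unfolding reduced_def by (simp add: le_floor_iff)

lemma u_Suc_bounds:
  "s - of_int (u (Suc n)) < of_int (v n)" "of_int (u (Suc n)) < s"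
  by (rule reduced_step[OF reduced_seq u_Suc[unfolded c_def]], assumption)+

section \<open>Running the expansion backwards\<close>

text \<open>
  Because the conjugate of the surd lies between \<open>-1\<close> and \<open>0\<close>, the fraction
  \<open>(u (n + 1) + s) / v n = c n + (s - u n) / v n\<close> has integer part \<open>c n\<close>.  So the partial
  quotient is visible from either end of a step.
\<close>
lemma digit_backward: "c n = digit (u (Suc n)) (v n)"
proof -
  have v: "real_of_int (v n) > 0" using v_pos by simp
  have "(of_int (u (Suc n)) + s) / of_int (v n) = of_int (c n) + (s - of_int (u n)) / of_int (v n)"
    using v by (simp add: u_Suc field_simps)
  moreover have "0 < (s - of_int (u n)) / of_int (v n)" "(s - of_int (u n)) / of_int (v n) < 1"
    using reduced_seq[of n] v unfolding reduced_def by (simp_all add: field_simps)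
  ultimately show ?thesis unfolding digit_def by (simp add: floor_eq_iff)
qed

lemma backward:
  assumes "u (Suc m) = u (Suc n)" "v (Suc m) = v (Suc n)"
  shows "u m = u n \<and> v m = v n"
proof -
  have "v m * v (Suc m) = v n * v (Suc m)" using norm_eq[of m] norm_eq[of n] assms by metis
  then have v: "v m = v n" using v_pos[of "Suc m"] by (metis less_irrefl mult_right_cancel)
  then have "c m = c n" using digit_backward assms by metis
  then show ?thesis using v assms u_Suc[of m] u_Suc[of n] by simp
qed

lemma state_eq_iff: "state m = state n \<longleftrightarrow> u m = u n \<and> v m = v n"
  by (simp add: u_def v_def prod_eq_iff)

lemma state_cancel:
  assumes "state (m + k) = state (n + k)"
  shows "state m = state n"
  using assms by (induction k) (auto simp: state_eq_iff dest: backward)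

lemma state_shift:
  assumes "state m = state n"
  shows "state (m + k) = state (n + k)"
  using assms by (induction k) (auto simp: state_Suc)

text \<open>
  Reduced states are bounded, so two states coincide; stepping back from both brings the
  coincidence down to the initial state.
\<close>
lemma state_recurs: "\<exists>k>0. state k = state 0"
proof -
  have "range state \<subseteq> {0..\<lfloor>s\<rfloor>} \<times> {0..2 * \<lfloor>s\<rfloor> + 1}"
  proof
    fix y assume "y \<in> range state"
    then obtain n where y: "y = (u n, v n)" by (auto simp: u_def v_def)
    have "real_of_int (v n) < s + of_int (u n)" using reduced_seq[of n] by (simp add: reduced_def)
    also have "\<dots> < of_int (\<lfloor>s\<rfloor> + 1) + of_int \<lfloor>s\<rfloor>" using u_le[of n] by linarith
    finally have "v n \<le> 2 * \<lfloor>s\<rfloor> + 1" by linarith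
    then show "y \<in> {0..\<lfloor>s\<rfloor>} \<times> {0..2 * \<lfloor>s\<rfloor> + 1}"
      using y u_le[of n] u_pos[of n] v_pos[of n] by simp
  qed
  then have "finite (range state)" by (rule finite_subset) simp
  then have "\<not> inj state" using finite_imageD by blast
  then obtain i j where "state i = state j" "i < j"
    unfolding inj_def by (metis linorder_neqE_nat)
  then have "state (0 + i) = state ((j - i) + i)" by simp
  then have "state (j - i) = state 0" using state_cancel by metis
  then show ?thesis using \<open>i < j\<close> by (intro exI[of _ "j - i"]) simp
qed

text \<open>
  Since \<open>c n * v n = u (n + 1) + u n \<le> 2 \<lfloor>s\<rfloor>\<close>, the partial quotient \<open>2 \<lfloor>s\<rfloor>\<close> requires
  \<open>v n = 1\<close>, and then reducedness leaves only \<open>u n = \<lfloor>s\<rfloor>\<close>.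
\<close>
lemma digit_max_iff: "c n = 2 * \<lfloor>s\<rfloor> \<longleftrightarrow> state n = state 0"
proof
  assume c: "c n = 2 * \<lfloor>s\<rfloor>"
  have r: "of_int (u n) < s" "s - of_int (u n) < of_int (v n)"
    using reduced_seq[of n] by (auto simp: reduced_def)
  have "v n = 1"
  proof (rule ccontr)
    assume "v n \<noteq> 1"
    then have "v n \<ge> 2" using v_pos[of n] by simp
    have "c n * v n = u (Suc n) + u n" using u_Suc[of n] by simp
    also have "\<dots> \<le> 2 * \<lfloor>s\<rfloor>" using u_le[of n] u_le[of "Suc n"] by simp
    finally have "2 * \<lfloor>s\<rfloor> * v n \<le> 2 * \<lfloor>s\<rfloor> * 1" using c by simp
    then show False using \<open>v n \<ge> 2\<close> floor_root_pos by (simp add: mult_le_cancel_left)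
  qed
  moreover have "u n = \<lfloor>s\<rfloor>" using r \<open>v n = 1\<close> by (intro floor_unique[symmetric]) auto
  ultimately show "state n = state 0" by (simp add: state_eq_iff start)
next
  assume "state n = state 0"
  then have "c n = digit \<lfloor>s\<rfloor> 1" by (simp add: c_def u_def v_def start[unfolded u_def v_def])
  then show "c n = 2 * \<lfloor>s\<rfloor>" by (simp add: digit_def)
qed

section \<open>The period and its symmetry\<close>

definition period :: nat where
  "period = (LEAST k. k > 0 \<and> state k = state 0)"

lemma period: "period > 0" "state period = state 0"
  using LeastI_ex[OF state_recurs] unfolding period_def by auto

lemma period_least: "k > 0 \<Longrightarrow> state k = state 0 \<Longrightarrow> period \<le> k"
  unfolding period_def by (simp add: Least_le)

lemma state_periodic: "state (n + period) = state n"
  using state_shift[OF period(2), of n] by (simp add: add.commute)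

lemma state_inj_below_period:
  assumes "state i = state j" "i < period" "j < period"
  shows "i = j"
proof -
  have *: "\<not> i < j" if "state i = state j" "j < period" for i j
  proof
    assume "i < j"
    with that have "state (0 + i) = state ((j - i) + i)" by simp
    then have "state (j - i) = state 0" using state_cancel by metis
    then show False using period_least[of "j - i"] \<open>i < j\<close> that by simp
  qed
  show ?thesis using *[of i j] *[of j i] assms by (metis linorder_neqE_nat)
qed

text \<open>
  The sequence run backwards from \<open>period\<close> obeys the same recurrence as the sequence run
  forwards from \<open>0\<close>, with the pair \<open>(u (k + 1), v k)\<close> in the role of a state.
  The two agree at the start because \<open>u 1 = u 0\<close>.
\<close>
lemma reflection:
  assumes "k < period"
  shows "u (Suc k) = u (period - k) \<and> v k = v (period - k)"
  using assms
proof (induction k)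
  case 0
  have "c 0 = 2 * \<lfloor>s\<rfloor>" by (simp add: digit_max_iff)
  then show ?case using period(2) by (simp add: u_Suc start state_eq_iff)
next
  case (Suc k)
  define m where "m = period - Suc k"
  have m: "period - k = Suc m" using Suc.prems by (simp add: m_def)
  have IH: "u (Suc k) = u (Suc m)" "v k = v (Suc m)" using Suc m by auto
  have "v k * v (Suc k) = v k * v m"
    using norm_eq[of k] norm_eq[of m] IH by (metis mult.commute)
  then have v: "v (Suc k) = v m" using v_pos[of k] by simp
  have "c m = c (Suc k)" using digit_backward[of m] v IH by (simp add: c_def)
  then have "u (Suc (Suc k)) = u m" using v IH u_Suc[of "Suc k"] u_Suc[of m] by simp
  with v show ?case by (simp add: m_def)
qed

lemma digit_palindrome:
  assumes "k < period"
  shows "c k = c (period - k)"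
  using digit_backward[of k] reflection[OF assms] by (simp add: c_def)

text \<open>
  Both \<open>u N\<close> and \<open>u (N + 1)\<close> lie strictly between \<open>s - v N\<close> and \<open>s\<close>, and both are
  multiples of \<open>v N\<close>.  So they are equal, and the cycle is symmetric about \<open>N\<close>.
\<close>
lemma period_symmetric_state:
  assumes N: "1 \<le> N" "N < period" and dvd: "v N dvd u N"
  shows "period = 2 * N"
proof -
  let ?w = "u (Suc N)"
  have r: "of_int (u N) < s" "s - of_int (u N) < of_int (v N)"
    using reduced_seq[of N] by (auto simp: reduced_def)
  have "v N dvd ?w - u N" using dvd by (simp add: u_Suc)
  moreover have "\<bar>?w - u N\<bar> < v N"
  proof -
    have "\<bar>real_of_int ?w - of_int (u N)\<bar> < of_int (v N)"
      using r u_Suc_bounds[of N] by linarith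
    then show ?thesis by linarith
  qed
  ultimately have "?w = u N" using zdvd_not_zless[of "\<bar>?w - u N\<bar>" "v N"] by force
  then have "state N = state (period - N)" using reflection[of N] N by (simp add: state_eq_iff)
  then have "N = period - N" using N by (intro state_inj_below_period) auto
  then show ?thesis using N by simp
qed

section \<open>Comparison with the expansion of the root\<close>

abbreviation a :: "nat \<Rightarrow> int" where "a \<equiv> partial_quotient s"

lemma complete_quotient_eq:
  "complete_quotient (of_int \<lfloor>s\<rfloor> + s) n = (of_int (u n) + s) / of_int (v n)"
proof (induction n)
  case 0
  show ?case by (simp add: start)
next
  case (Suc n)
  let ?w = "u (Suc n)"
  have v: "real_of_int (v n) > 0" "real_of_int (v (Suc n)) > 0" using v_pos by simp_all
  have w: "s - of_int ?w > 0" using u_Suc_bounds(2) by simp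
  have "real_of_int (v n * v (Suc n)) = real_of_int (int d - ?w\<^sup>2)" by (simp only: norm_eq)
  then have prod: "of_int (v n) * of_int (v (Suc n)) = (of_int ?w + s) * (s - of_int ?w)"
    by (simp add: power2_eq_square algebra_simps)
  have "(of_int (u n) + s) / of_int (v n) - of_int (c n) = (s - of_int ?w) / of_int (v n)"
    using v by (simp add: u_Suc field_simps)
  then have "complete_quotient (of_int \<lfloor>s\<rfloor> + s) (Suc n) = of_int (v n) / (s - of_int ?w)"
    using Suc by (simp add: c_def digit_def)
  also have "\<dots> = (of_int ?w + s) / of_int (v (Suc n))"
    using prod v w by (simp add: frac_eq_eq)
  finally show ?case .
qed

lemma a_0: "a 0 = \<lfloor>s\<rfloor>"
  by (simp add: partial_quotient_def)

lemma a_Suc: "a (Suc n) = c (Suc n)"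
  using complete_quotient_add_int[of "\<lfloor>s\<rfloor>" s n] complete_quotient_eq[of "Suc n"]
  by (simp only: partial_quotient_def c_def digit_def)

lemma a_eq: "k > 0 \<Longrightarrow> a k = c k"
  using a_Suc by (metis Suc_pred)

lemma periodic_a: "periodic_from 1 period a"
proof -
  have "a (n + period) = a n" if "n \<ge> 1" for n
    using that state_periodic[of n] by (simp add: a_eq c_def u_def v_def)
  then show ?thesis using period(1) by (simp add: periodic_from_def)
qed

text \<open>
  A period of the partial quotients shifts the value \<open>2 \<lfloor>s\<rfloor>\<close> at \<open>period\<close> to a later
  index, which must be another return to the initial state.
\<close>
lemma smallest_period_a: "smallest_period 1 a = period"
  unfolding smallest_period_def
proof (rule Least_equality)
  show "periodic_from 1 period a" by (rule periodic_a)
next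
  fix T assume T: "periodic_from 1 T a"
  then have "a (period + T) = a period" using period(1) by (simp add: periodic_from_def)
  then have "c (period + T) = 2 * \<lfloor>s\<rfloor>"
    using period by (simp add: a_eq digit_max_iff)
  then have "state (T + period) = state 0" by (simp add: digit_max_iff add.commute)
  then have "state T = state 0" by (simp add: state_periodic)
  then show "period \<le> T" using T by (intro period_least) (simp add: periodic_from_def)
qed

section \<open>Norms of the convergents\<close>

abbreviation p :: "int \<Rightarrow> int" where "p \<equiv> conv_num a"
abbreviation q :: "int \<Rightarrow> int" where "q \<equiv> conv_denom a"

text \<open>
  These are the rational and irrational parts of \<open>s * (q n * y + q (n - 1)) =
  p n * y + p (n - 1)\<close> for the complete quotient \<open>y = (u (n + 1) + s) / v (n + 1)\<close>,
  after multiplication by \<open>v (n + 1)\<close>.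
\<close>
lemma convergent_surd:
  "p (int n) = q (int n) * u (Suc n) + q (int n - 1) * v (Suc n) \<and>
   int d * q (int n) = p (int n) * u (Suc n) + p (int n - 1) * v (Suc n)"
proof (induction n)
  case 0
  have "c 0 = 2 * \<lfloor>s\<rfloor>" by (simp add: digit_max_iff)
  then have u1: "u 1 = \<lfloor>s\<rfloor>" using u_Suc[of 0] by (simp add: start)
  have p0: "p 0 = \<lfloor>s\<rfloor>" "q 0 = 1"
    using conv_num_rec(3)[of a 0] conv_denom_rec(3)[of a 0]
    by (simp_all add: conv_num_rec(1,2) conv_denom_rec(1,2) a_0)
  show ?case using norm_eq[of 0] u1 p0
    by (simp add: start conv_num_rec(2) conv_denom_rec(2) power2_eq_square)
next
  case (Suc n)
  let ?u = "u (Suc n)" and ?v = "v (Suc n)" and ?u' = "u (Suc (Suc n))" and ?v' = "v (Suc (Suc n))"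
  let ?P = "p (int n)" and ?Q = "q (int n)" and ?Pm = "p (int n - 1)" and ?Qm = "q (int n - 1)"
  let ?c = "c (Suc n)"
  have A: "?P = ?Q * ?u + ?Qm * ?v" and B: "int d * ?Q = ?P * ?u + ?Pm * ?v" using Suc by auto
  have P': "p (int (Suc n)) = ?c * ?P + ?Pm" and Q': "q (int (Suc n)) = ?c * ?Q + ?Qm"
    by (simp_all only: conv_num_Suc conv_denom_Suc a_Suc)
  have u': "?u' = ?c * ?v - ?u" by (rule u_Suc)
  have N: "?v * ?v' = int d - ?u' * ?u'" using norm_eq[of "Suc n"] by (simp add: power2_eq_square)
  \<comment> \<open>The product with \<open>?v\<close> lets \<open>?v * ?v'\<close> be replaced by \<open>d - ?u'\<^sup>2\<close>; \<open>?v\<close> is cancelled at the end.\<close>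
  have "?v * ((?c * ?Q + ?Qm) * ?u' + ?Q * ?v') = ?u' * (?c * ?v * ?Q + ?Qm * ?v) + ?Q * (?v * ?v')"
    by (simp add: algebra_simps)
  also have "\<dots> = ?u' * (?Q * (?c * ?v - ?u') + ?Qm * ?v) + int d * ?Q"
    unfolding N by (simp add: algebra_simps)
  also have "\<dots> = ?u' * ?P + int d * ?Q" using A by (simp add: u')
  also have "\<dots> = ?v * (?c * ?P + ?Pm)" unfolding B by (simp add: u' algebra_simps)
  finally have A': "?c * ?P + ?Pm = (?c * ?Q + ?Qm) * ?u' + ?Q * ?v'" using v_pos[of "Suc n"] by simp
  have "?v * ((?c * ?P + ?Pm) * ?u' + ?P * ?v') = ?u' * (?c * ?v * ?P + ?Pm * ?v) + ?P * (?v * ?v')"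
    by (simp add: algebra_simps)
  also have "\<dots> = ?u' * (?P * (?c * ?v - ?u') + ?Pm * ?v) + int d * ?P"
    unfolding N by (simp add: algebra_simps)
  also have "\<dots> = ?u' * (int d * ?Q) + int d * ?P" using B by (simp add: u')
  also have "\<dots> = int d * (?u' * ?Q + (?Q * ?u + ?Qm * ?v))"
    using A by (simp add: algebra_simps)
  also have "\<dots> = ?v * (int d * (?c * ?Q + ?Qm))" by (simp add: u' algebra_simps)
  finally have B': "int d * (?c * ?Q + ?Qm) = (?c * ?P + ?Pm) * ?u' + ?P * ?v'"
    using v_pos[of "Suc n"] by simp
  have "int (Suc n) - 1 = int n" by simp
  then show ?case using A' B' by (simp only: P' Q')
qed

lemma convergent_norm: "(p (int n - 1))\<^sup>2 - int d * (q (int n - 1))\<^sup>2 = (-1) ^ n * v n"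
proof (cases n)
  case 0
  then show ?thesis by (simp add: start conv_num_rec(2) conv_denom_rec(2))
next
  case (Suc m)
  let ?P = "p (int m)" and ?Q = "q (int m)" and ?Pm = "p (int m - 1)" and ?Qm = "q (int m - 1)"
  have A: "?P = ?Q * u n + ?Qm * v n" and B: "int d * ?Q = ?P * u n + ?Pm * v n"
    using convergent_surd[of m] Suc by auto
  have "?P\<^sup>2 - int d * ?Q\<^sup>2 = ?P * ?P - (int d * ?Q) * ?Q" by (simp add: power2_eq_square)
  also have "\<dots> = ?P * (?Q * u n + ?Qm * v n) - (?P * u n + ?Pm * v n) * ?Q"
    using A B by simp
  also have "\<dots> = (?P * ?Qm - ?Pm * ?Q) * v n" by (simp add: algebra_simps)
  finally show ?thesis using conv_determinant[of a m] Suc by simp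
qed

end

theorem mainTheorem3:
  fixes d T :: nat and x :: real and a :: "nat \<Rightarrow> int" and p q :: "int \<Rightarrow> int"
  assumes nonsquare: "\<not> is_square d"
  defines "x \<equiv> of_int \<lfloor>sqrt (real d)\<rfloor> + sqrt (real d)"
    and "a \<equiv> partial_quotient (sqrt (real d))"
    and "p \<equiv> conv_num a"
    and "q \<equiv> conv_denom a"
    and "T \<equiv> smallest_period 1 a"
  shows "(periodic_from 1 T a \<and> a T = 2 * a 0 \<and> (\<forall>k\<in>{1..T-1}. a k = a (T - k)))
    \<and> (\<exists>u v :: nat \<Rightarrow> int.
         (periodic_from 0 T u \<and> periodic_from 0 T v \<and>
          (\<forall>n. u n > 0 \<and> v n > 0 \<and>
               complete_quotient x n = (of_int (u n) + sqrt (real d)) / of_int (v n) \<and>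
               u n \<le> a 0 \<and> v n dvd int d - (u n)\<^sup>2))
       \<and> (\<forall>n::nat. (p (int n - 1))\<^sup>2 - int d * (q (int n - 1))\<^sup>2 = (-1) ^ n * v n)
       \<and> (\<forall>N\<in>{1..T-1}. v N dvd u N \<longrightarrow> T = 2 * N \<and> even T))
    \<and> (a T = 2 * a 0 \<and> (\<forall>k<T. a k \<noteq> 2 * a 0))"
proof -
  interpret root: nonsquare_root d by unfold_locales (rule nonsquare)
  have T: "T = root.period" unfolding T_def a_def by (rule root.smallest_period_a)
  have Tpos: "T > 0" using root.period(1) T by simp
  have per: "periodic_from 1 T a" using root.periodic_a T a_def by simp
  have a0: "a 0 = \<lfloor>sqrt (real d)\<rfloor>" unfolding a_def by (rule root.a_0)
  have ac: "a k = root.c k" if "k > 0" for k unfolding a_def by (rule root.a_eq[OF that])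
  have aT: "a T = 2 * a 0"
    using root.period by (simp add: ac a0 T root.digit_max_iff)
  have pal: "a k = a (T - k)" if "k \<in> {1..T-1}" for k
    using that root.digit_palindrome[of k] T by (auto simp: ac)
  have first: "a k \<noteq> 2 * a 0" if "k < T" for k
  proof (cases "k = 0")
    case True
    have "a 0 \<ge> 1" unfolding a0 by (rule root.floor_root_pos)
    with True show ?thesis by simp
  next
    case False
    then show ?thesis
      using root.period_least[of k] that T by (auto simp: ac a0 root.digit_max_iff)
  qed
  have uv: "periodic_from 0 T root.u" "periodic_from 0 T root.v"
    using Tpos root.state_periodic
    by (simp_all add: periodic_from_def T root.u_def root.v_def)
  have cq: "complete_quotient x n = (of_int (root.u n) + sqrt (real d)) / of_int (root.v n)" for n
    unfolding x_def by (rule root.complete_quotient_eq)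
  have dvd: "root.v n dvd int d - (root.u n)\<^sup>2" for n
    using root.reduced_seq[of n] by (simp add: root.reduced_def)
  have norm: "(p (int n - 1))\<^sup>2 - int d * (q (int n - 1))\<^sup>2 = (-1) ^ n * root.v n" for n
    unfolding p_def q_def a_def by (rule root.convergent_norm)
  have half: "T = 2 * N \<and> even T" if "N \<in> {1..T-1}" "root.v N dvd root.u N" for N
  proof -
    have "1 \<le> N" "N < root.period" using that(1) Tpos unfolding T by auto
    then have "T = 2 * N" using root.period_symmetric_state[OF _ _ that(2)] T by simp
    then show ?thesis by simp
  qed
  have bounds: "root.u n > 0 \<and> root.v n > 0 \<and> root.u n \<le> a 0" for n
    using root.u_pos root.v_pos root.u_le a0 by simp
  show ?thesis
    using per aT pal first
    by (intro conjI exI[of _ root.u] exI[of _ root.v])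
       (use uv cq dvd norm half bounds in \<open>blast+\<close>)
qed

end
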